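(* Let $d>1$, $\bm b\in\mathbb R^d\setminus\{\mathbf 0\}$, $\hat{\bm b}=\bm b/\|\bm b\|_2$, and suppose the prior $\pi_{\bm w}$ of $\bm w_\ell^*(D)$ is factorized along $\hat{\bm b}$, i.e. the conflict projection $s=\hat{\bm b}^\top\bm w_\ell^*(D)\in[\underline s,\bar s]\subseteq\mathbb R$ and the agreement component $\mathbf z=\bm w_\ell^*(D)-s\hat{\bm b}$ are independent: $\pi_{\bm w}=\pi_s\otimes\pi_{\mathbf z}$. Then any one-dimensional equilibrium partition of $s$ with bias $\beta=\|\bm b\|_2$ lifts to a multidimensional equilibrium that reveals $\mathbf z$ exactly and manipulates only along $\hat{\bm b}$. If the scalar partition is user-optimal, then its lift is user-optimal among lifted equilibria.
   Context: Multidimensional game. A user holds a private dataset $D$; the only payoff-relevant information in it is the learner-optimal parameter $\bm w_\ell^*(D)\in\mathcal W\subseteq\mathbb R^d$, distributed according to a commonly known prior $\pi_{\bm w}$. The user observes $\bm w_\ell^*(D)$ and sends a costless, unverifiable report; the learner observes only the report and then deploys a parameter $\bm w$. Utilities are $U^\ell(D,\bm w)=-\|\bm w-\bm w_\ell^*(D)\|_2^2$ (learner) and $U^r(D,\bm w)=-\|\bm w-(\bm w_\ell^*(D)+\bm b)\|_2^2$ (user). In equilibrium the learner responds to each report with the posterior mean of $\bm w_\ell^*(D)$ (its best response under quadratic utility), and at every value of $\bm w_\ell^*(D)$ the user's report maximizes the user's utility among the available reports given the learner's responses. One-dimensional problem. The state is $s\in[\underline s,\bar s]$ with prior $\pi_s$,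 the learner's utility is $-(a-s)^2$ and the user's is $-(a-(s+\beta))^2$ for learner action $a\in\mathbb R$. A partition $\underline s=t_0<t_1<\cdots<t_n=\bar s$ (each interval with positive $\pi_s$-mass) is a one-dimensional equilibrium partition if, with $\Phi_i=\mathbb E_{\pi_s}[s\mid s\in[t_{i-1},t_i]]$, every $s$ assigned to interval $i$ satisfies $(\Phi_i-s-\beta)^2\le(\Phi_j-s-\beta)^2$ for all $j$ (fixed tie-breaking at cutpoints). It is user-optimal if it maximizes the user's ex ante expected utility among one-dimensional equilibrium partitions. Lift. The lift of such a partition is the strategy in which the user reports the cell $$R_i(\mathbf z)=\{\bm w\in\mathcal W:\ \bm w-(\hat{\bm b}^\top\bm w)\hat{\bm b}=\mathbf z,\ \hat{\bm b}^\top\bm w\in[t_{i-1},t_i]\}$$ containing $\bm w_\ell^*(D)$ (the available reports are the cells $R_j(\mathbf z')$). Lifted equilibria are the multidimensional equilibria that are lifts of one-dimensional equilibrium partitions; user-optimality among them refers to the user's ex ante expected utility.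
   Formalization: Each mean Φ_i and the positive-mass condition use the states assigned to interval i under the fixed tie-breaking rule, not the closed interval; they agree when cutpoints have no prior mass, and with atoms at cutpoints the literal claim can fail. W is taken to be Borel. *)

theory Defs
  imports "HOL-Probability.Probability"
begin

text \<open>
  The dataset enters payoffs only through the learner-optimal parameter, so the states of the
  game are the possible values \<open>w\<close> of that parameter.
\<close>

section \<open>Conflict and agreement components\<close>

definition conflict_dir :: "'a::euclidean_space \<Rightarrow> 'a" where
  "conflict_dir b = b /\<^sub>R norm b"

definition conflict :: "'a::euclidean_space \<Rightarrow> 'a \<Rightarrow> real" where
  "conflict b w = conflict_dir b \<bullet> w"

definition agreement :: "'a::euclidean_space \<Rightarrow> 'a \<Rightarrow> 'a" where
  "agreement b w = w - conflict b w *\<^sub>R conflict_dir b"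


section \<open>The multidimensional game\<close>

definition user_utility :: "'a::euclidean_space \<Rightarrow> 'a \<Rightarrow> 'a \<Rightarrow> real" where
  "user_utility b w a = - (norm (a - (w + b)))\<^sup>2"

text \<open>
  \<open>report_info P \<rho>\<close> is what the learner observes when the state is drawn from \<open>P\<close> and
  reported through \<open>\<rho>\<close>: the measurable sets of states whose occurrence is decided by the report.
  These are the measurable preimages under \<open>\<rho>\<close>; no sigma-algebra on reports is needed.
\<close>

definition report_info :: "'a measure \<Rightarrow> ('a \<Rightarrow> 'r) \<Rightarrow> 'a measure" where
  "report_info P \<rho> =
     sigma (space P) {A \<in> sets P. \<forall>x\<in>A. \<forall>y\<in>space P. \<rho> x = \<rho> y \<longrightarrow> y \<in> A}"

text \<open>
  \<open>posterior_mean P \<rho> \<alpha>\<close>: the response \<open>\<alpha>\<close> to the report is a version of the conditional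
  expectation of the state given the report. Conditional expectations are scalar in the library,
  hence the quantification over directions \<open>v\<close>. As \<open>real_cond_exp\<close> is a total function, the
  finiteness condition says that the conditional mean really exists; the prior itself need not
  have a finite mean.
\<close>

definition posterior_mean ::
    "'a::euclidean_space measure \<Rightarrow> ('a \<Rightarrow> 'r) \<Rightarrow> ('r \<Rightarrow> 'a) \<Rightarrow> bool" where
  "posterior_mean P \<rho> \<alpha> \<longleftrightarrow>
     (\<lambda>w. \<alpha> (\<rho> w)) \<in> borel_measurable (report_info P \<rho>) \<and>
     (AE w in P. nn_cond_exp P (report_info P \<rho>) (\<lambda>w. ennreal (norm w)) w < \<infinity>) \<and>
     (\<forall>v. AE w in P. \<alpha> (\<rho> w) \<bullet> v = real_cond_exp P (report_info P \<rho>) (\<lambda>w. w \<bullet> v) w)"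

text \<open>
  \<open>Rep\<close> is the set of available reports. The user's optimality is required at every state,
  against every available report, including reports that no state sends.
\<close>

definition equilibrium ::
    "'a::euclidean_space measure \<Rightarrow> 'a \<Rightarrow> 'r set \<Rightarrow> ('a \<Rightarrow> 'r) \<Rightarrow> ('r \<Rightarrow> 'a) \<Rightarrow> bool" where
  "equilibrium P b Rep \<rho> \<alpha> \<longleftrightarrow>
     (\<forall>w\<in>space P. \<rho> w \<in> Rep) \<and>
     posterior_mean P \<rho> \<alpha> \<and>
     (\<forall>w\<in>space P. \<forall>r\<in>Rep. user_utility b w (\<alpha> r) \<le> user_utility b w (\<alpha> (\<rho> w)))"

definition ex_ante_user_utility ::
    "'a::euclidean_space measure \<Rightarrow> 'a \<Rightarrow> ('a \<Rightarrow> 'r) \<Rightarrow> ('r \<Rightarrow> 'a) \<Rightarrow> real" where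
  "ex_ante_user_utility P b \<rho> \<alpha> = (\<integral>w. user_utility b w (\<alpha> (\<rho> w)) \<partial>P)"

definition reveals_agreement ::
    "'a::euclidean_space measure \<Rightarrow> 'a \<Rightarrow> ('a \<Rightarrow> 'r) \<Rightarrow> bool" where
  "reveals_agreement P b \<rho> \<longleftrightarrow> (\<exists>g. \<forall>w\<in>space P. g (\<rho> w) = agreement b w)"

definition manipulates_only_along ::
    "'a::euclidean_space measure \<Rightarrow> 'a \<Rightarrow> ('a \<Rightarrow> 'r) \<Rightarrow> ('r \<Rightarrow> 'a) \<Rightarrow> bool" where
  "manipulates_only_along P b \<rho> \<alpha> \<longleftrightarrow>
     (\<forall>w\<in>space P. \<exists>c. \<alpha> (\<rho> w) = w + c *\<^sub>R conflict_dir b)"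


section \<open>The one-dimensional problem\<close>

text \<open>
  The intervals of \<open>t 0 < \<dots> < t n\<close> are numbered \<open>1, \<dots>, n\<close>. The tie-breaking rule \<open>up\<close> sends
  an interior cutpoint \<open>c\<close> to the interval above it if \<open>up c\<close> holds, and to the one below
  otherwise. \<open>scalar_cell up n t i\<close> is the set of \<open>s\<close> assigned to interval \<open>i\<close>, that is
  \<open>{t (i - 1)..t i}\<close> up to its endpoints.
\<close>

definition scalar_cell :: "(real \<Rightarrow> bool) \<Rightarrow> nat \<Rightarrow> (nat \<Rightarrow> real) \<Rightarrow> nat \<Rightarrow> real set" where
  "scalar_cell up n t i =
     {s \<in> {t (i - 1)..t i}.
        (s = t (i - 1) \<longrightarrow> i = 1 \<or> up s) \<and> (s = t i \<longrightarrow> i = n \<or> \<not> up s)}"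

definition cell_index :: "(real \<Rightarrow> bool) \<Rightarrow> nat \<Rightarrow> (nat \<Rightarrow> real) \<Rightarrow> real \<Rightarrow> nat" where
  "cell_index up n t s = (THE i. i \<in> {1..n} \<and> s \<in> scalar_cell up n t i)"

text \<open>
  The mean is conditional on the states assigned to interval \<open>i\<close>, so that it is the posterior mean
  given report \<open>i\<close> also when a cutpoint is an atom of the prior. If the cutpoints are null, it is
  the mean over the closed interval; see \<open>cell_mean_closed\<close> below.
\<close>

definition cell_mean ::
    "real measure \<Rightarrow> (real \<Rightarrow> bool) \<Rightarrow> nat \<Rightarrow> (nat \<Rightarrow> real) \<Rightarrow> nat \<Rightarrow> real" where
  "cell_mean \<pi> up n t i = (\<integral>s. s \<partial>uniform_measure \<pi> (scalar_cell up n t i))"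

definition scalar_partition ::
    "real measure \<Rightarrow> real \<Rightarrow> real \<Rightarrow> (real \<Rightarrow> bool) \<Rightarrow> nat \<Rightarrow> (nat \<Rightarrow> real) \<Rightarrow> bool" where
  "scalar_partition \<pi> lo hi up n t \<longleftrightarrow>
     0 < n \<and> t 0 = lo \<and> t n = hi \<and> (\<forall>i<n. t i < t (Suc i)) \<and>
     (\<forall>i\<in>{1..n}. 0 < measure \<pi> (scalar_cell up n t i))"

definition scalar_equilibrium ::
    "real \<Rightarrow> real measure \<Rightarrow> real \<Rightarrow> real \<Rightarrow> (real \<Rightarrow> bool) \<Rightarrow> nat \<Rightarrow> (nat \<Rightarrow> real) \<Rightarrow> bool" where
  "scalar_equilibrium \<beta> \<pi> lo hi up n t \<longleftrightarrow>
     scalar_partition \<pi> lo hi up n t \<and>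
     (\<forall>i\<in>{1..n}. \<forall>s\<in>scalar_cell up n t i. \<forall>j\<in>{1..n}.
        (cell_mean \<pi> up n t i - s - \<beta>)\<^sup>2 \<le> (cell_mean \<pi> up n t j - s - \<beta>)\<^sup>2)"

definition scalar_ex_ante_utility ::
    "real \<Rightarrow> real measure \<Rightarrow> (real \<Rightarrow> bool) \<Rightarrow> nat \<Rightarrow> (nat \<Rightarrow> real) \<Rightarrow> real" where
  "scalar_ex_ante_utility \<beta> \<pi> up n t =
     (\<integral>s. - (cell_mean \<pi> up n t (cell_index up n t s) - (s + \<beta>))\<^sup>2 \<partial>\<pi>)"

definition scalar_user_optimal ::
    "real \<Rightarrow> real measure \<Rightarrow> real \<Rightarrow> real \<Rightarrow> (real \<Rightarrow> bool) \<Rightarrow> nat \<Rightarrow> (nat \<Rightarrow> real) \<Rightarrow> bool" where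
  "scalar_user_optimal \<beta> \<pi> lo hi up n t \<longleftrightarrow>
     scalar_equilibrium \<beta> \<pi> lo hi up n t \<and>
     (\<forall>n' t'. scalar_equilibrium \<beta> \<pi> lo hi up n' t' \<longrightarrow>
        scalar_ex_ante_utility \<beta> \<pi> up n' t' \<le> scalar_ex_ante_utility \<beta> \<pi> up n t)"

lemma ex1_scalar_cell:
  assumes "0 < n" "\<forall>i<n. t i < t (Suc i)" "s \<in> {t 0..t n}"
  shows "\<exists>!i. i \<in> {1..n} \<and> s \<in> scalar_cell up n t i"
proof -
  have mono: "t i < t j" if "i < j" "j \<le> n" for i j
    using that
  proof (induction j)
    case (Suc j)
    then have "t j < t (Suc j)" using assms(2) by simp
    then show ?case using Suc by (cases "i = j") auto
  qed simp
  define P where "P k \<longleftrightarrow> 1 \<le> k \<and> k \<le> n \<and> (s < t k \<or> k = n \<or> (s = t k \<and> \<not> up s))" for k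
  define k where "k = (LEAST k. P k)"
  have "P n" using assms(1) by (simp add: P_def)
  then have Pk: "P k" unfolding k_def by (rule LeastI)
  have least: "\<not> P j" if "j < k" for j using that unfolding k_def by (rule not_less_Least)
  have "s \<in> scalar_cell up n t k"
  proof (cases "k = 1")
    case True
    then show ?thesis using Pk assms(3) by (auto simp: P_def scalar_cell_def)
  next
    case False
    then have "1 \<le> k - 1" "k - 1 < n" "\<not> P (k - 1)" using Pk least[of "k - 1"] by (auto simp: P_def)
    then show ?thesis using Pk assms(3) False by (auto simp: P_def scalar_cell_def)
  qed
  moreover have False
    if "i < j" "1 \<le> i" "j \<le> n" "s \<in> scalar_cell up n t i" "s \<in> scalar_cell up n t j" for i j
  proof -
    have "i = j - 1 \<or> i < j - 1" "j - 1 \<le> n" using that by linarith+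
    then have "t i \<le> t (j - 1)" using mono[of i "j - 1"] by auto
    then have "s = t i" "s = t (j - 1)" using that by (auto simp: scalar_cell_def)
    then show False using that by (auto simp: scalar_cell_def)
  qed
  ultimately show ?thesis
    using Pk unfolding P_def atLeastAtMost_iff by (metis linorder_neqE_nat)
qed

lemma cell_mean_closed:
  assumes "finite_measure \<pi>" "sets \<pi> = sets borel"
    and "measure \<pi> {t (i - 1)} = 0" "measure \<pi> {t i} = 0"
  shows "cell_mean \<pi> up n t i = (\<integral>s. s \<partial>uniform_measure \<pi> {t (i - 1)..t i})"
proof -
  interpret finite_measure \<pi> by fact
  let ?C = "scalar_cell up n t i" and ?I = "{t (i - 1)..t i}"
  have C: "?C \<in> sets \<pi>" and I: "?I \<in> sets \<pi>"
  proof -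
    have "?C = ?I - ({t (i - 1), t i} \<inter> - ?C)" "finite ({t (i - 1), t i} \<inter> - ?C)"
      by (auto simp: scalar_cell_def)
    then show "?C \<in> sets \<pi>" using assms(2) by (metis atLeastAtMost_borel finite_imp_closed borel_closed sets.Diff)
    show "?I \<in> sets \<pi>" using assms(2) by simp
  qed
  have "{t (i - 1)} \<in> null_sets \<pi>" "{t i} \<in> null_sets \<pi>"
    using assms by (auto simp: null_sets_def emeasure_eq_measure)
  then have ae: "AE s in \<pi>. s \<noteq> t (i - 1) \<and> s \<noteq> t i"
    by (auto dest!: AE_not_in)
  have "AE s in \<pi>. s \<in> ?C \<longleftrightarrow> s \<in> ?I"
    using ae by eventually_elim (auto simp: scalar_cell_def)
  then have "emeasure \<pi> ?C = emeasure \<pi> ?I"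
    using C I by (rule emeasure_eq_AE)
  moreover have "AE s in \<pi>. indicator ?C s / emeasure \<pi> ?I = indicator ?I s / emeasure \<pi> ?I"
    using ae by eventually_elim (auto simp: scalar_cell_def indicator_def)
  ultimately have "uniform_measure \<pi> ?C = uniform_measure \<pi> ?I"
    unfolding uniform_measure_def using C I by (intro density_cong) auto
  then show ?thesis by (simp add: cell_mean_def)
qed


section \<open>Lifts\<close>

definition lift_cell ::
    "'a::euclidean_space set \<Rightarrow> 'a \<Rightarrow> (nat \<Rightarrow> real) \<Rightarrow> nat \<Rightarrow> 'a \<Rightarrow> 'a set" where
  "lift_cell W b t i z = {w \<in> W. agreement b w = z \<and> conflict b w \<in> {t (i - 1)..t i}}"

definition lift_reports ::
    "'a::euclidean_space set \<Rightarrow> 'a \<Rightarrow> nat \<Rightarrow> (nat \<Rightarrow> real) \<Rightarrow> 'a set set" where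
  "lift_reports W b n t = {lift_cell W b t j z |j z. j \<in> {1..n}}"

definition lift_strategy ::
    "'a::euclidean_space set \<Rightarrow> 'a \<Rightarrow> (real \<Rightarrow> bool) \<Rightarrow> nat \<Rightarrow> (nat \<Rightarrow> real) \<Rightarrow> 'a \<Rightarrow> 'a set" where
  "lift_strategy W b up n t w =
     lift_cell W b t (cell_index up n t (conflict b w)) (agreement b w)"

text \<open>
  In the next two definitions \<open>P\<close> is the prior of the state and \<open>\<pi>\<close> that of its conflict
  projection; the bias of the one-dimensional problem is \<open>norm b\<close>.
\<close>

definition lifted_equilibrium ::
    "'a::euclidean_space measure \<Rightarrow> real measure \<Rightarrow> 'a set \<Rightarrow> 'a \<Rightarrow> real \<Rightarrow> real \<Rightarrow> (real \<Rightarrow> bool) \<Rightarrow>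
     nat \<Rightarrow> (nat \<Rightarrow> real) \<Rightarrow> ('a set \<Rightarrow> 'a) \<Rightarrow> bool" where
  "lifted_equilibrium P \<pi> W b lo hi up n t \<alpha> \<longleftrightarrow>
     scalar_equilibrium (norm b) \<pi> lo hi up n t \<and>
     equilibrium P b (lift_reports W b n t) (lift_strategy W b up n t) \<alpha>"

definition user_optimal_lifted ::
    "'a::euclidean_space measure \<Rightarrow> real measure \<Rightarrow> 'a set \<Rightarrow> 'a \<Rightarrow> real \<Rightarrow> real \<Rightarrow> (real \<Rightarrow> bool) \<Rightarrow>
     nat \<Rightarrow> (nat \<Rightarrow> real) \<Rightarrow> ('a set \<Rightarrow> 'a) \<Rightarrow> bool" where
  "user_optimal_lifted P \<pi> W b lo hi up n t \<alpha> \<longleftrightarrow>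
     lifted_equilibrium P \<pi> W b lo hi up n t \<alpha> \<and>
     (\<forall>n' t' \<alpha>'. lifted_equilibrium P \<pi> W b lo hi up n' t' \<alpha>' \<longrightarrow>
        ex_ante_user_utility P b (lift_strategy W b up n' t') \<alpha>'
        \<le> ex_ante_user_utility P b (lift_strategy W b up n t) \<alpha>)"

end

theory Submission
  imports Defs
begin

text \<open>
  By Pythagoras the user's loss splits into a loss in the agreement component and the loss of the
  one-dimensional problem with bias \<open>norm b\<close>. If the learner's response to a cell has the agreement
  component of that cell and the scalar mean of its interval, then deviating to another agreement
  component only adds a loss, and within a line the scalar equilibrium condition applies.

  What needs an argument is that this response is the posterior mean. By Fubini, almost every line
  carries full \<open>\<pi>s\<close>-mass in the state space, and a set decided by the report contains all or
  nothing of the states on such a line that are sent to one interval; so integrating the state minus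
  the response over it gives zero. The posterior mean is almost surely unique, hence every lifted
  equilibrium has the ex ante utility of its scalar partition.
\<close>

section \<open>Orthogonal decomposition along the conflict direction\<close>

lemma norm_conflict_dir: "b \<noteq> 0 \<Longrightarrow> norm (conflict_dir b) = 1"
  by (simp add: conflict_dir_def)

lemma conflict_dir_inner_self: "b \<noteq> 0 \<Longrightarrow> conflict_dir b \<bullet> conflict_dir b = 1"
  using norm_conflict_dir by (simp add: norm_eq_1)

lemma agreement_plus_conflict: "agreement b w + conflict b w *\<^sub>R conflict_dir b = w"
  by (simp add: agreement_def)

lemma conflict_dir_inner_agreement: "b \<noteq> 0 \<Longrightarrow> conflict_dir b \<bullet> agreement b w = 0"
  by (simp add: agreement_def conflict_def inner_diff_right conflict_dir_inner_self)

text \<open>The bias is \<open>norm b\<close> times the unit vector \<open>conflict_dir b\<close>,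
  so it only shifts the coordinate along that vector; agreement components are orthogonal to it and
  the cross term drops out. The action borrows the agreement component of a second state
  \<open>w'\<close> because a deviation imitates such a state.\<close>

lemma user_utility_eq:
  assumes "b \<noteq> 0"
  shows "user_utility b w (agreement b w' + x *\<^sub>R conflict_dir b) =
    - (norm (agreement b w' - agreement b w))\<^sup>2 - (x - conflict b w - norm b)\<^sup>2"
proof -
  let ?u = "conflict_dir b"
  let ?d = "agreement b w' - agreement b w" and ?y = "x - conflict b w - norm b"
  have "b = norm b *\<^sub>R ?u" using assms by (simp add: conflict_dir_def)
  then have "agreement b w' + x *\<^sub>R ?u - (w + b) = ?d + ?y *\<^sub>R ?u"
    using agreement_plus_conflict[of b w] by (simp add: algebra_simps)
  moreover have "?d \<bullet> ?u = 0"
    using assms by (metis conflict_dir_inner_agreement inner_commute inner_diff_right diff_self)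
  then have "(norm (?d + ?y *\<^sub>R ?u))\<^sup>2 = (norm ?d)\<^sup>2 + ?y\<^sup>2"
    using assms unfolding power2_norm_eq_inner
    by (simp add: inner_add_left inner_add_right inner_commute[of ?u ?d]
        conflict_dir_inner_self power2_eq_square)
  ultimately show ?thesis by (simp only: user_utility_def)
qed

lemma borel_measurable_conflict [measurable (raw)]:
  "f \<in> borel_measurable M \<Longrightarrow> (\<lambda>x. conflict b (f x)) \<in> borel_measurable M"
  unfolding conflict_def by measurable

lemma borel_measurable_agreement [measurable (raw)]:
  "f \<in> borel_measurable M \<Longrightarrow> (\<lambda>x. agreement b (f x)) \<in> borel_measurable M"
  unfolding agreement_def
  by (intro borel_measurable_diff borel_measurable_scaleR borel_measurable_conflict) auto


section \<open>The information in a report\<close>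

lemma space_report_info [simp]: "space (report_info P \<rho>) = space P"
  by (simp add: report_info_def space_measure_of_conv)

text \<open>The measurable sets that are unions of report classes already form a sigma-algebra, so
  generating one adds nothing. Closure under complement rests on the symmetry of having equal
  reports.\<close>

lemma sets_report_info:
  "sets (report_info P \<rho>) =
     {A \<in> sets P. \<forall>x\<in>A. \<forall>y\<in>space P. \<rho> x = \<rho> y \<longrightarrow> y \<in> A}" (is "_ = ?F")
proof -
  have "sigma_algebra (space P) ?F"
    unfolding sigma_algebra_iff2
  proof (intro conjI ballI allI impI)
    fix A assume A: "A \<in> ?F"
    have "y \<in> space P - A" if "x \<in> space P - A" "y \<in> space P" "\<rho> x = \<rho> y" for x y
    proof -
      have "x \<in> A" if "y \<in> A" using A that \<open>x \<in> space P - A\<close> \<open>\<rho> x = \<rho> y\<close> by auto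
      then show ?thesis using that by auto
    qed
    moreover have "space P - A \<in> sets P" using A by (intro sets.compl_sets) simp
    ultimately show "space P - A \<in> ?F" by blast
  next
    fix A :: "nat \<Rightarrow> 'a set" assume A: "range A \<subseteq> ?F"
    then have "A i \<in> ?F" for i by (rule range_subsetD)
    then have "A i \<in> sets P"
      and sat: "\<forall>x\<in>A i. \<forall>y\<in>space P. \<rho> x = \<rho> y \<longrightarrow> y \<in> A i" for i
      by blast+
    then have "(\<Union>i. A i) \<in> sets P" by blast
    then show "(\<Union>i. A i) \<in> ?F" using sat by blast
  qed (auto dest: sets.sets_into_space)
  then show ?thesis
    unfolding report_info_def by (rule sigma_algebra.sets_measure_of_eq)
qed

lemma subalgebra_report_info: "subalgebra P (report_info P \<rho>)"
  unfolding subalgebra_def sets_report_info by auto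

text \<open>Preimages under a function that is constant on report classes are decided by the report.
  This stands in for a factorization through the space of reports, which carries no
  sigma-algebra.\<close>

lemma measurable_report_info:
  assumes "f \<in> measurable P N"
    and "\<And>x y. x \<in> space P \<Longrightarrow> y \<in> space P \<Longrightarrow> \<rho> x = \<rho> y \<Longrightarrow> f x = f y"
  shows "f \<in> measurable (report_info P \<rho>) N"
proof (rule measurableI)
  fix A assume "A \<in> sets N"
  then have "f -` A \<inter> space P \<in> sets P" using assms(1) by simp
  moreover have "y \<in> f -` A \<inter> space P"
    if "x \<in> f -` A \<inter> space P" "y \<in> space P" "\<rho> x = \<rho> y" for x y
    using that assms(2)[of x y] by simp
  ultimately show "f -` A \<inter> space (report_info P \<rho>) \<in> sets (report_info P \<rho>)"
    unfolding sets_report_info space_report_info by blast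
qed (use assms(1) in \<open>auto dest: measurable_space\<close>)


section \<open>Cells of a scalar partition\<close>

text \<open>The rule \<open>up\<close> is an arbitrary predicate, possibly non-measurable, but a
  cell consults it only at its two endpoints, where it is a constant.\<close>

lemma sets_scalar_cell [measurable]: "scalar_cell up n t i \<in> sets borel"
proof -
  have "scalar_cell up n t i =
    {s. t (i - 1) \<le> s \<and> s \<le> t i \<and> (s = t (i - 1) \<longrightarrow> i = 1 \<or> up (t (i - 1))) \<and>
        (s = t i \<longrightarrow> i = n \<or> \<not> up (t i))}"
    by (auto simp: scalar_cell_def)
  also have "\<dots> \<in> sets borel" by measurable
  finally show ?thesis .
qed

lemma scalar_partition_mono:
  assumes "scalar_partition \<pi> lo hi up n t" "i \<le> j" "j \<le> n"
  shows "t i \<le> t j"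
  using assms(2,3)
proof (induction j)
  case (Suc j)
  then have "t j < t (Suc j)" using assms(1) by (simp add: scalar_partition_def)
  then show ?case using Suc by (cases "i = Suc j") auto
qed simp

lemma scalar_cell_subset:
  assumes "scalar_partition \<pi> lo hi up n t" "i \<in> {1..n}"
  shows "scalar_cell up n t i \<subseteq> {lo..hi}"
proof -
  have "lo \<le> t (i - 1)" "t i \<le> hi"
    using scalar_partition_mono[OF assms(1), of 0 "i - 1"] scalar_partition_mono[OF assms(1), of i n]
      assms by (auto simp: scalar_partition_def)
  then show ?thesis by (auto simp: scalar_cell_def)
qed

lemma cell_index_props:
  assumes "scalar_partition \<pi> lo hi up n t" "s \<in> {lo..hi}"
  shows "cell_index up n t s \<in> {1..n}" "s \<in> scalar_cell up n t (cell_index up n t s)"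
  using theI'[OF ex1_scalar_cell[of n t s up]] assms
  by (auto simp: scalar_partition_def cell_index_def)

lemma cell_index_eq:
  assumes "scalar_partition \<pi> lo hi up n t" "i \<in> {1..n}" "s \<in> scalar_cell up n t i"
  shows "cell_index up n t s = i"
proof -
  have "s \<in> {lo..hi}" using scalar_cell_subset[OF assms(1,2)] assms(3) by blast
  then show ?thesis
    using ex1_scalar_cell[of n t s up] cell_index_props[OF assms(1), of s] assms
    unfolding scalar_partition_def by blast
qed

text \<open>There are finitely many candidates, and at most one of them fits a given point. Outside
  \<open>{lo..hi}\<close> none fits and \<open>THE\<close> returns one fixed unspecified value, so
  measurability holds on the whole line.\<close>

lemma measurable_cell_index:
  assumes "scalar_partition \<pi> lo hi up n t"
  shows "cell_index up n t \<in> measurable borel (count_space UNIV)"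
  unfolding cell_index_def
proof (rule measurable_THE[where I = "{1..n}"])
  show "i = j" if "i \<in> {1..n} \<and> s \<in> scalar_cell up n t i"
    "j \<in> {1..n} \<and> s \<in> scalar_cell up n t j" for s i j
    using that cell_index_eq[OF assms] by metis
qed auto


section \<open>Lifts under a factorized prior\<close>

text \<open>The game is treated through the law \<open>P\<close> of the parameter alone. The law
  \<open>\<pi>z\<close> lives on the full space, not on the orthogonal complement of
  \<open>b\<close>; \<open>AE_line\<close> discards the unsuitable \<open>z\<close>.\<close>

locale factorized_prior = prob_space P
  for P :: "'a::euclidean_space measure" +
  fixes \<pi>s :: "real measure" and \<pi>z :: "'a measure" and W :: "'a set" and b :: 'a
    and lo hi :: real
  assumes bias: "b \<noteq> 0"
    and sets_W: "W \<in> sets borel"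
    and sets_P: "sets P = sets (restrict_space borel {w \<in> W. conflict b w \<in> {lo..hi}})"
    and conflict_prior: "\<pi>s = distr P borel (conflict b)"
    and agreement_prior: "\<pi>z = distr P borel (agreement b)"
    and factorized:
      "distr P (borel \<Otimes>\<^sub>M borel) (\<lambda>w. (conflict b w, agreement b w)) = \<pi>s \<Otimes>\<^sub>M \<pi>z"
begin

abbreviation u where "u \<equiv> conflict_dir b"

lemma space_P: "space P = {w \<in> W. conflict b w \<in> {lo..hi}}"
  using sets_eq_imp_space_eq[OF sets_P] by (simp add: space_restrict_space)

lemma sets_space_P: "space P \<in> sets borel"
proof -
  have [measurable]: "W \<in> sets borel" by (rule sets_W)
  show ?thesis unfolding space_P by measurable
qed

lemma sets_P_borel: "A \<in> sets P \<Longrightarrow> A \<in> sets borel"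
  using sets_space_P unfolding sets_P space_P by (auto simp: sets_restrict_space)

lemma measurable_ident_P [measurable]: "(\<lambda>w. w) \<in> borel_measurable P"
  using measurable_restrict_space1[OF measurable_ident, of borel "space P"] sets_P
  unfolding space_P id_def by (subst measurable_cong_sets) auto

lemma sets_conflict_prior [simp, measurable_cong]: "sets \<pi>s = sets borel"
  by (simp add: conflict_prior)

lemma sets_agreement_prior [simp, measurable_cong]: "sets \<pi>z = sets borel"
  by (simp add: agreement_prior)

sublocale s: prob_space \<pi>s
  unfolding conflict_prior by (rule prob_space_distr) measurable

sublocale z: prob_space \<pi>z
  unfolding agreement_prior by (rule prob_space_distr) measurable

sublocale sz: pair_prob_space \<pi>s \<pi>z ..

lemma AE_conflict_prior: "AE s in \<pi>s. s \<in> {lo..hi}"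
  unfolding conflict_prior by (subst AE_distr_iff) (auto simp: space_P)

lemma integral_conflict_prior:
  fixes f :: "real \<Rightarrow> real"
  assumes "f \<in> borel_measurable borel"
  shows "(\<integral>s. f s \<partial>\<pi>s) = (\<integral>w. f (conflict b w) \<partial>P)"
  unfolding conflict_prior using assms by (subst integral_distr) auto

text \<open>The conflict projection is bounded, so only the agreement component can make a state
  large.\<close>

lemma norm_state_le:
  assumes "w \<in> space P"
  shows "norm w \<le> norm (agreement b w) + max \<bar>lo\<bar> \<bar>hi\<bar>"
proof -
  have "norm w \<le> norm (agreement b w) + \<bar>conflict b w\<bar>"
    using norm_triangle_ineq[of "agreement b w" "conflict b w *\<^sub>R u"] norm_conflict_dir[OF bias]
    by (simp add: agreement_plus_conflict)
  then show ?thesis using assms by (auto simp: space_P)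
qed

text \<open>The condition holds surely at the two components of a state, and by factorization their
  joint law is the product, so Fubini yields it on almost every line. The last two clauses are
  included because a given \<open>z\<close> need not be orthogonal to \<open>u\<close>.\<close>

lemma AE_line:
  "AE z in \<pi>z. AE s in \<pi>s. z + s *\<^sub>R u \<in> space P \<and> conflict b (z + s *\<^sub>R u) = s \<and>
     agreement b (z + s *\<^sub>R u) = z"
proof -
  note sets_space_P [measurable]
  let ?Q = "\<lambda>s z. z + s *\<^sub>R u \<in> space P \<and> conflict b (z + s *\<^sub>R u) = s \<and>
    agreement b (z + s *\<^sub>R u) = z"
  have meas: "{p \<in> space (\<pi>s \<Otimes>\<^sub>M \<pi>z). ?Q (fst p) (snd p)} \<in> sets (\<pi>s \<Otimes>\<^sub>M \<pi>z)"
    by measurable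
  have "AE p in \<pi>s \<Otimes>\<^sub>M \<pi>z. ?Q (fst p) (snd p)"
    unfolding factorized[symmetric]
  proof (subst AE_distr_iff)
    show "{p \<in> space (borel \<Otimes>\<^sub>M borel). ?Q (fst p) (snd p)} \<in> sets (borel \<Otimes>\<^sub>M borel)"
      by measurable
  qed (auto simp: agreement_plus_conflict)
  then have "AE s in \<pi>s. AE z in \<pi>z. ?Q s z" 
    using sz.AE_pair[where Q = "\<lambda>p. ?Q (fst p) (snd p)"] by simp
  then show ?thesis using sz.AE_commute[where P = "?Q", OF meas] by simp
qed

end

section \<open>One scalar partition and the candidate response to its lift\<close>

locale lifted_partition = factorized_prior +
  fixes up :: "real \<Rightarrow> bool" and n :: nat and t :: "nat \<Rightarrow> real"
  assumes partition: "scalar_partition \<pi>s lo hi up n t"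
begin

abbreviation cell where "cell \<equiv> scalar_cell up n t"
abbreviation idx where "idx \<equiv> cell_index up n t"
abbreviation \<Phi> where "\<Phi> \<equiv> cell_mean \<pi>s up n t"
abbreviation \<rho> where "\<rho> \<equiv> lift_strategy W b up n t"

text \<open>Defined on states rather than reports, so that measurability makes sense;
  \<open>response_cong\<close> shows that it depends on the state only through the report.\<close>

definition response :: "'a \<Rightarrow> 'a" where
  "response w = agreement b w + \<Phi> (idx (conflict b w)) *\<^sub>R u"

lemma measurable_idx [measurable]: "idx \<in> measurable borel (count_space UNIV)"
  by (rule measurable_cell_index[OF partition])

lemma borel_measurable_response [measurable]: "response \<in> borel_measurable P"
  unfolding response_def by measurable

text \<open>
  Reports are sets of states, so the cells of different intervals on a line may coincide; this
  happens only if the state space meets both in their common cutpoint alone.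
\<close>

lemma lift_strategy_eqD:
  assumes w: "w \<in> space P" "w' \<in> space P" and eq: "\<rho> w = \<rho> w'"
  shows "agreement b w = agreement b w'" "idx (conflict b w) = idx (conflict b w')"
proof -
  define i j where "i = idx (conflict b w)" and "j = idx (conflict b w')"
  have ij: "i \<in> {1..n}" "j \<in> {1..n}" "conflict b w \<in> cell i" "conflict b w' \<in> cell j"
    using cell_index_props[OF partition] w by (auto simp: space_P i_def j_def)
  \<comment> \<open>Each state lies in the cell it reports, so equal reports put both projections
    into both closed intervals.\<close>
  then have "w \<in> \<rho> w" "w' \<in> \<rho> w'"
    using w by (auto simp: lift_strategy_def lift_cell_def scalar_cell_def space_P i_def j_def)
  then have "w \<in> \<rho> w'" "w' \<in> \<rho> w" using eq by auto
  then have same: "agreement b w = agreement b w'"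
    and mem: "conflict b w \<in> {t (j - 1)..t j}" "conflict b w' \<in> {t (i - 1)..t i}"
    by (auto simp: lift_strategy_def lift_cell_def i_def j_def)
  \<comment> \<open>Different intervals share at most an endpoint, so the two projections coincide;
    but equal projections have equal indices, which rules out \<open>i \<noteq> j\<close>.\<close>
  have "conflict b w = conflict b w'" if "i \<noteq> j"
  proof -
    have "t i \<le> t (j - 1) \<or> t j \<le> t (i - 1)"
      using scalar_partition_mono[OF partition, of i "j - 1"]
        scalar_partition_mono[OF partition, of j "i - 1"] ij that by force
    then show ?thesis using mem ij(3,4) by (auto simp: scalar_cell_def)
  qed
  then show "idx (conflict b w) = idx (conflict b w')" unfolding i_def j_def by metis
  show "agreement b w = agreement b w'" by (rule same)
qed

lemma response_cong:
  "w \<in> space P \<Longrightarrow> w' \<in> space P \<Longrightarrow> \<rho> w = \<rho> w' \<Longrightarrow> response w = response w'"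
  using lift_strategy_eqD[of w w'] unfolding response_def by metis

section \<open>Mean-zero errors on cells, on lines and on report events\<close>

lemma integrable_indicator_cell: "integrable \<pi>s (\<lambda>s. indicator (cell i) s * s)"
proof (rule s.integrable_const_bound)
  show "AE s in \<pi>s. norm (indicator (cell i) s * s) \<le> max \<bar>lo\<bar> \<bar>hi\<bar>"
    using AE_conflict_prior by eventually_elim (auto simp: indicator_def)
qed measurable

lemma integrable_indicator_cell_centred:
  "integrable \<pi>s (\<lambda>s. indicator (cell i) s * (s - \<Phi> i))"
proof -
  have "integrable \<pi>s (\<lambda>s. indicator (cell i) s * s - indicator (cell i) s * \<Phi> i)"
    by (intro Bochner_Integration.integrable_diff integrable_indicator_cell
        integrable_mult_left integrable_real_indicator) (auto simp: s.emeasure_eq_measure)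
  then show ?thesis by (simp add: right_diff_distrib)
qed

text \<open>The cell mean is the integral over the cell divided by its mass; the mass is positive in
  a partition, so the denominator can be cleared.\<close>

lemma integral_cell_centred:
  assumes "i \<in> {1..n}"
  shows "(\<integral>s. indicator (cell i) s * (s - \<Phi> i) \<partial>\<pi>s) = 0"
proof -
  let ?m = "measure \<pi>s (cell i)"
  have m: "0 < ?m" using partition assms by (auto simp: scalar_partition_def)
  have "uniform_measure \<pi>s (cell i) = density \<pi>s (\<lambda>s. ennreal (indicator (cell i) s / ?m))"
    unfolding uniform_measure_def using m
    by (intro density_cong) (auto simp: s.emeasure_eq_measure indicator_def divide_ennreal[symmetric])
  then have "\<Phi> i = (\<integral>s. (indicator (cell i) s / ?m) *\<^sub>R s \<partial>\<pi>s)"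
    unfolding cell_mean_def using m by (simp add: integral_density)
  also have "\<dots> = (\<integral>s. indicator (cell i) s * s \<partial>\<pi>s) / ?m" by simp
  finally have "(\<integral>s. indicator (cell i) s * s \<partial>\<pi>s) = \<Phi> i * ?m" using m by simp
  then show ?thesis
    by (simp add: right_diff_distrib integrable_indicator_cell s.emeasure_eq_measure)
qed

text \<open>Along the line, \<open>A\<close> agrees almost everywhere with a union of cells, so the
  integral splits into centred cell integrals, each of them zero.\<close>

lemma integral_line_eq_0:
  assumes A: "A \<in> sets (report_info P \<rho>)"
    and line: "AE s in \<pi>s. z + s *\<^sub>R u \<in> space P \<and> conflict b (z + s *\<^sub>R u) = s \<and>
      agreement b (z + s *\<^sub>R u) = z" (is "AE s in \<pi>s. ?Q s")
  shows "(\<integral>s. indicator A (z + s *\<^sub>R u) * (s - \<Phi> (idx s)) \<partial>\<pi>s) = 0"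
proof -
  have sat: "y \<in> A" if "x \<in> A" "y \<in> space P" "\<rho> x = \<rho> y" for x y
    using A that by (auto simp: sets_report_info)
  have [measurable]: "A \<in> sets borel" using A sets_P_borel by (auto simp: sets_report_info)
  \<comment> \<open>\<open>\<kappa> i\<close> is 1 iff some state of the line sent to interval
    \<open>i\<close> lies in \<open>A\<close>; as \<open>A\<close> is decided by the report, all
    such states then do.\<close>
  define \<kappa> :: "nat \<Rightarrow> real" where
    "\<kappa> i = (if \<exists>s\<in>cell i. ?Q s \<and> z + s *\<^sub>R u \<in> A then 1 else 0)" for i
  have pointwise: "indicator A (z + s *\<^sub>R u) * (s - \<Phi> (idx s)) =
      (\<Sum>i\<in>{1..n}. \<kappa> i * (indicator (cell i) s * (s - \<Phi> i)))" if s: "?Q s" for s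
  proof -
    have rng: "s \<in> {lo..hi}" using s by (auto simp: space_P)
    note idx = cell_index_props[OF partition rng]
    have "z + s *\<^sub>R u \<in> A" if "r \<in> cell (idx s)" "?Q r" "z + r *\<^sub>R u \<in> A" for r
    proof -
      have "idx r = idx s" using cell_index_eq[OF partition idx(1) that(1)] .
      then have "\<rho> (z + r *\<^sub>R u) = \<rho> (z + s *\<^sub>R u)"
        using s that by (simp add: lift_strategy_def)
      then show ?thesis using sat that s by blast
    qed
    then have "\<kappa> (idx s) = indicator A (z + s *\<^sub>R u)"
      using idx s by (auto simp: \<kappa>_def indicator_def)
    moreover have "(\<Sum>i\<in>{1..n}. \<kappa> i * (indicator (cell i) s * (s - \<Phi> i))) =
        (\<Sum>i\<in>{1..n}. if i = idx s then \<kappa> i * (s - \<Phi> i) else 0)"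
    proof (rule sum.cong)
      fix i assume "i \<in> {1..n}"
      then have "s \<in> cell i \<longleftrightarrow> i = idx s"
        using idx(2) cell_index_eq[OF partition] by metis
      then show "\<kappa> i * (indicator (cell i) s * (s - \<Phi> i)) =
          (if i = idx s then \<kappa> i * (s - \<Phi> i) else 0)"
        by (simp add: indicator_def)
    qed simp
    ultimately show ?thesis using idx by simp
  qed
  have "(\<integral>s. indicator A (z + s *\<^sub>R u) * (s - \<Phi> (idx s)) \<partial>\<pi>s) =
      (\<integral>s. (\<Sum>i\<in>{1..n}. \<kappa> i * (indicator (cell i) s * (s - \<Phi> i))) \<partial>\<pi>s)"
  proof (rule integral_cong_AE)
    show "AE s in \<pi>s. indicator A (z + s *\<^sub>R u) * (s - \<Phi> (idx s)) =
        (\<Sum>i\<in>{1..n}. \<kappa> i * (indicator (cell i) s * (s - \<Phi> i)))"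
      using line by (rule eventually_mono) (rule pointwise)
  qed measurable
  also have "\<dots> = (\<Sum>i\<in>{1..n}. \<kappa> i * (\<integral>s. indicator (cell i) s * (s - \<Phi> i) \<partial>\<pi>s))"
    by (simp add: integrable_indicator_cell_centred)
  also have "\<dots> = 0" by (simp add: integral_cell_centred)
  finally show ?thesis .
qed

text \<open>The index takes finitely many values, so the sum of all absolute cell means dominates
  whichever one occurs. The uniform bound serves integrability.\<close>

lemma conflict_error_bound:
  assumes "s \<in> {lo..hi}"
  shows "\<bar>s - \<Phi> (idx s)\<bar> \<le> max \<bar>lo\<bar> \<bar>hi\<bar> + (\<Sum>i\<in>{1..n}. \<bar>\<Phi> i\<bar>)"
proof -
  have "\<bar>\<Phi> (idx s)\<bar> \<le> (\<Sum>i\<in>{1..n}. \<bar>\<Phi> i\<bar>)"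
    using cell_index_props[OF partition assms] by (intro member_le_sum) auto
  then show ?thesis using assms by auto
qed

lemma integral_conflict_error_eq_0:
  assumes A: "A \<in> sets (report_info P \<rho>)"
  shows "(\<integral>w. indicator A w * (conflict b w - \<Phi> (idx (conflict b w))) \<partial>P) = 0"
proof -
  let ?h = "\<lambda>s z. indicator A (z + s *\<^sub>R u) * (s - \<Phi> (idx s))"
  have [measurable]: "A \<in> sets borel" using A sets_P_borel by (auto simp: sets_report_info)
  have h: "case_prod ?h \<in> borel_measurable (borel \<Otimes>\<^sub>M borel)" by measurable
  have "integrable P (\<lambda>w. ?h (conflict b w) (agreement b w))"
  proof (rule integrable_const_bound)
    show "AE w in P. norm (?h (conflict b w) (agreement b w))
        \<le> max \<bar>lo\<bar> \<bar>hi\<bar> + (\<Sum>i\<in>{1..n}. \<bar>\<Phi> i\<bar>)"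
    proof (rule AE_I2)
      fix w assume "w \<in> space P"
      then show "norm (?h (conflict b w) (agreement b w))
          \<le> max \<bar>lo\<bar> \<bar>hi\<bar> + (\<Sum>i\<in>{1..n}. \<bar>\<Phi> i\<bar>)"
        using conflict_error_bound[of "conflict b w"]
        by (auto simp: indicator_def space_P intro: order_trans[OF abs_ge_zero])
    qed
  qed measurable
  then have int: "integrable (\<pi>s \<Otimes>\<^sub>M \<pi>z) (case_prod ?h)"
    unfolding factorized[symmetric] using h by (subst integrable_distr_eq) auto
  \<comment> \<open>A state is recovered from its components, so the integrand is a function of the
    pair, whose law is the product; the inner integral then runs along a line.\<close>
  have "(\<integral>w. indicator A w * (conflict b w - \<Phi> (idx (conflict b w))) \<partial>P) =
      (\<integral>w. case_prod ?h (conflict b w, agreement b w) \<partial>P)"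
    by (simp add: agreement_plus_conflict)
  also have "\<dots> = (\<integral>p. case_prod ?h p \<partial>(\<pi>s \<Otimes>\<^sub>M \<pi>z))"
    unfolding factorized[symmetric] using h by (subst integral_distr) auto
  also have "\<dots> = (\<integral>z. (\<integral>s. ?h s z \<partial>\<pi>s) \<partial>\<pi>z)"
    using sz.integral_snd[OF int] by simp
  also have "\<dots> = (\<integral>z. 0 \<partial>\<pi>z)"
  proof (rule integral_cong_AE)
    show "AE z in \<pi>z. (\<integral>s. ?h s z \<partial>\<pi>s) = 0"
      using AE_line by (rule eventually_mono) (rule integral_line_eq_0[OF A])
  qed measurable
  finally show ?thesis by simp
qed

section \<open>Conditional expectation given the report\<close>

sublocale info: finite_measure_subalgebra P "report_info P \<rho>"
  by unfold_locales (rule subalgebra_report_info)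

lemma borel_measurable_response_info [measurable]:
  "response \<in> borel_measurable (report_info P \<rho>)"
  by (rule measurable_report_info) (auto intro: response_cong)

lemma borel_measurable_agreement_info [measurable]:
  "agreement b \<in> borel_measurable (report_info P \<rho>)"
  by (rule measurable_report_info) (auto dest: lift_strategy_eqD)

text \<open>
  The agreement component may have infinite mean. It is decided by the report, so the state is first
  restricted to the sets of bounded agreement component, where it is integrable.
\<close>

lemma real_cond_exp_state:
  "AE w in P. real_cond_exp P (report_info P \<rho>) (\<lambda>w. w \<bullet> v) w = response w \<bullet> v"
proof -
  define I :: "nat \<Rightarrow> 'a \<Rightarrow> real"
    where "I k w = (if norm (agreement b w) \<le> real k then 1 else 0)" for k w
  have I [measurable]: "I k \<in> borel_measurable (report_info P \<rho>)" for k
    unfolding I_def by measurable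
  have IP [measurable]: "I k \<in> borel_measurable P" for k
    by (rule measurable_from_subalg[OF subalgebra_report_info I])
  let ?B = "max \<bar>lo\<bar> \<bar>hi\<bar> + (\<Sum>i\<in>{1..n}. \<bar>\<Phi> i\<bar>)"
  have response_diff: "w - response w = (conflict b w - \<Phi> (idx (conflict b w))) *\<^sub>R u" for w
    using agreement_plus_conflict[of b w] by (simp add: response_def algebra_simps)
  \<comment> \<open>The first bound uses the truncation; in the second the agreement components
    cancel and the bounded error along \<open>u\<close> remains. Their difference makes the
    truncated response integrable.\<close>
  have bound: "norm (I k w * (w \<bullet> v)) \<le> (real k + max \<bar>lo\<bar> \<bar>hi\<bar>) * norm v"
    "norm (I k w * ((w - response w) \<bullet> v)) \<le> ?B * norm v" if w: "w \<in> space P" for k w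
  proof -
    have "0 \<le> ?B" by (intro add_nonneg_nonneg sum_nonneg) auto
    have I01: "0 \<le> I k w" "I k w \<le> 1" by (auto simp: I_def)
    have "I k w * norm w \<le> real k + max \<bar>lo\<bar> \<bar>hi\<bar>"
      using norm_state_le[OF w] by (auto simp: I_def)
    then have "I k w * norm w * norm v \<le> (real k + max \<bar>lo\<bar> \<bar>hi\<bar>) * norm v"
      by (rule mult_right_mono) simp
    moreover have "norm (I k w * (w \<bullet> v)) \<le> I k w * (norm w * norm v)"
      using mult_left_mono[OF Cauchy_Schwarz_ineq2[of w v] I01(1)] I01 by (simp add: abs_mult)
    ultimately show "norm (I k w * (w \<bullet> v)) \<le> (real k + max \<bar>lo\<bar> \<bar>hi\<bar>) * norm v" by simp
    have "norm (w - response w) \<le> ?B"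
      using conflict_error_bound[of "conflict b w"] w norm_conflict_dir[OF bias]
      by (simp add: response_diff space_P)
    then have "I k w * norm (w - response w) \<le> ?B" using \<open>0 \<le> ?B\<close> by (simp add: I_def)
    then have "I k w * norm (w - response w) * norm v \<le> ?B * norm v"
      by (rule mult_right_mono) simp
    moreover have "norm (I k w * ((w - response w) \<bullet> v)) \<le> I k w * (norm (w - response w) * norm v)"
      using mult_left_mono[OF Cauchy_Schwarz_ineq2[of "w - response w" v] I01(1)] I01
      by (simp add: abs_mult)
    ultimately show "norm (I k w * ((w - response w) \<bullet> v)) \<le> ?B * norm v" by simp
  qed
  have int: "integrable P (\<lambda>w. I k w * (w \<bullet> v))" for k
    using bound(1) by (intro integrable_const_bound[where B = "(real k + max \<bar>lo\<bar> \<bar>hi\<bar>) * norm v"]) auto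
  have int': "integrable P (\<lambda>w. I k w * ((w - response w) \<bullet> v))" for k
    using bound(2) by (intro integrable_const_bound[where B = "?B * norm v"]) auto
  have int_response: "integrable P (\<lambda>w. I k w * (response w \<bullet> v))" for k
    using Bochner_Integration.integrable_diff[OF int[of k] int'[of k]]
    by (simp add: inner_diff_left algebra_simps)
  have "AE w in P. real_cond_exp P (report_info P \<rho>) (\<lambda>w. I k w * (w \<bullet> v)) w =
      I k w * (response w \<bullet> v)" (is "AE w in P. ?charact k w") for k
  proof (rule info.real_cond_exp_charact[OF _ int int_response])
    fix A assume A: "A \<in> sets (report_info P \<rho>)"
    then have AP: "A \<in> sets P" by (simp add: sets_report_info)
    \<comment> \<open>The truncation is absorbed into the test set, which stays decided by the
      report because the agreement component is.\<close>
    let ?A = "A \<inter> {w \<in> space P. norm (agreement b w) \<le> real k}"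
    have "{w \<in> space (report_info P \<rho>). norm (agreement b w) \<le> real k} \<in> sets (report_info P \<rho>)"
      by measurable
    then have A': "?A \<in> sets (report_info P \<rho>)"
      unfolding space_report_info by (rule sets.Int[OF A])
    have "(\<integral>w\<in>A. I k w * (w \<bullet> v) \<partial>P) - (\<integral>w\<in>A. I k w * (response w \<bullet> v) \<partial>P) =
        (\<integral>w\<in>A. I k w * (w \<bullet> v) - I k w * (response w \<bullet> v) \<partial>P)"
      using integrable_mult_indicator[OF AP int] integrable_mult_indicator[OF AP int_response]
      by (subst set_integral_diff) (auto simp: set_integrable_def)
    also have "\<dots> = (\<integral>w. (indicator ?A w * (conflict b w - \<Phi> (idx (conflict b w)))) * (u \<bullet> v) \<partial>P)"
      unfolding set_lebesgue_integral_def
    proof (rule Bochner_Integration.integral_cong)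
      fix w assume "w \<in> space P"
      have "w \<bullet> v - response w \<bullet> v = (conflict b w - \<Phi> (idx (conflict b w))) * (u \<bullet> v)"
        using response_diff[of w] by (metis inner_diff_left inner_scaleR_left)
      then show "indicator A w *\<^sub>R (I k w * (w \<bullet> v) - I k w * (response w \<bullet> v)) =
          indicator ?A w * (conflict b w - \<Phi> (idx (conflict b w))) * (u \<bullet> v)"
        using \<open>w \<in> space P\<close> by (auto simp: I_def indicator_def)
    qed simp
    also have "\<dots> = 0" using integral_conflict_error_eq_0[OF A'] by simp
    finally show "(\<integral>w\<in>A. I k w * (w \<bullet> v) \<partial>P) = (\<integral>w\<in>A. I k w * (response w \<bullet> v) \<partial>P)" by simp
  qed measurable
  \<comment> \<open>The truncation is measurable for the report and can be pulled out; integrability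
    is required of the product only, not of the state itself.\<close>
  moreover have "AE w in P. real_cond_exp P (report_info P \<rho>) (\<lambda>w. I k w * (w \<bullet> v)) w =
      I k w * real_cond_exp P (report_info P \<rho>) (\<lambda>w. w \<bullet> v) w" (is "AE w in P. ?pull_out k w") for k
    by (rule info.real_cond_exp_mult[OF _ _ int]) measurable
  ultimately have "AE w in P. \<forall>k. ?charact k w \<and> ?pull_out k w"
    unfolding AE_all_countable by (intro allI AE_conjI)
  then have "AE w in P. \<forall>k. I k w * real_cond_exp P (report_info P \<rho>) (\<lambda>w. w \<bullet> v) w =
      I k w * (response w \<bullet> v)"
    by (rule eventually_mono) metis
  then show ?thesis
  proof eventually_elim
    case (elim w)
    \<comment> \<open>At this \<open>k\<close> the truncation equals 1 at \<open>w\<close> and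
      cancels from the identity.\<close>
    obtain k where "norm (agreement b w) \<le> real k" using real_arch_simple by blast
    then show ?case using elim[rule_format, of k] by (simp add: I_def)
  qed
qed

text \<open>The dominating function depends on the agreement component alone, so it is known from
  the report and is its own conditional expectation; it is finite everywhere.\<close>

lemma nn_cond_exp_norm_finite:
  "AE w in P. nn_cond_exp P (report_info P \<rho>) (\<lambda>w. ennreal (norm w)) w < \<infinity>"
proof -
  let ?f = "\<lambda>w. ennreal (norm (agreement b w) + max \<bar>lo\<bar> \<bar>hi\<bar>)"
  have "AE w in P. nn_cond_exp P (report_info P \<rho>) (\<lambda>w. ennreal (norm w)) w
      \<le> nn_cond_exp P (report_info P \<rho>) ?f w"
    by (intro info.nn_cond_exp_mono AE_I2 ennreal_leI norm_state_le) measurable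
  moreover have "AE w in P. ?f w = nn_cond_exp P (report_info P \<rho>) ?f w"
    by (rule info.nn_cond_exp_F_meas) measurable
  ultimately show ?thesis
    by eventually_elim (metis ennreal_less_top infinity_ennreal_def le_less_trans)
qed

lemma posterior_meanI:
  assumes "\<And>w. w \<in> space P \<Longrightarrow> \<alpha> (\<rho> w) = response w"
  shows "posterior_mean P \<rho> \<alpha>"
  unfolding posterior_mean_def
proof (intro conjI allI)
  show "(\<lambda>w. \<alpha> (\<rho> w)) \<in> borel_measurable (report_info P \<rho>)"
    using borel_measurable_response_info by (rule measurable_cong[THEN iffD2, rotated]) (simp add: assms)
  show "AE w in P. \<alpha> (\<rho> w) \<bullet> v = real_cond_exp P (report_info P \<rho>) (\<lambda>w. w \<bullet> v) w" for v
    using real_cond_exp_state[of v] AE_space by eventually_elim (simp add: assms)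
qed (rule nn_cond_exp_norm_finite)

text \<open>Each direction has its own exceptional null set; testing against the finite basis leaves
  a single one.\<close>

lemma posterior_meanD:
  assumes "posterior_mean P \<rho> \<alpha>"
  shows "AE w in P. \<alpha> (\<rho> w) = response w"
proof -
  have "AE w in P. \<alpha> (\<rho> w) \<bullet> v = response w \<bullet> v" for v
  proof -
    have "AE w in P. \<alpha> (\<rho> w) \<bullet> v = real_cond_exp P (report_info P \<rho>) (\<lambda>w. w \<bullet> v) w"
      using assms by (simp add: posterior_mean_def)
    then show ?thesis using real_cond_exp_state[of v] by eventually_elim simp
  qed
  then have "AE w in P. \<forall>v\<in>Basis. \<alpha> (\<rho> w) \<bullet> v = response w \<bullet> v"
    by (intro AE_finite_allI) auto
  then show ?thesis by eventually_elim (auto intro: euclidean_eqI)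
qed

text \<open>Almost surely the response keeps the agreement component of the state, so the agreement
  loss vanishes and the scalar loss remains.\<close>

lemma ex_ante_user_utility_lift:
  assumes "posterior_mean P \<rho> \<alpha>"
  shows "ex_ante_user_utility P b \<rho> \<alpha> = scalar_ex_ante_utility (norm b) \<pi>s up n t"
proof -
  have [measurable]: "(\<lambda>w. \<alpha> (\<rho> w)) \<in> borel_measurable P"
    using assms measurable_from_subalg[OF subalgebra_report_info]
    by (auto simp: posterior_mean_def)
  have "ex_ante_user_utility P b \<rho> \<alpha> =
      (\<integral>w. - (\<Phi> (idx (conflict b w)) - (conflict b w + norm b))\<^sup>2 \<partial>P)"
    unfolding ex_ante_user_utility_def
  proof (rule integral_cong_AE)
    show "(\<lambda>w. user_utility b w (\<alpha> (\<rho> w))) \<in> borel_measurable P"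
      unfolding user_utility_def by measurable
    show "AE w in P. user_utility b w (\<alpha> (\<rho> w)) =
        - (\<Phi> (idx (conflict b w)) - (conflict b w + norm b))\<^sup>2"
      using posterior_meanD[OF assms]
      by eventually_elim (simp add: response_def user_utility_eq[OF bias] diff_diff_eq)
  qed measurable
  also have "\<dots> = scalar_ex_ante_utility (norm b) \<pi>s up n t"
    unfolding scalar_ex_ante_utility_def
    by (rule integral_conflict_prior[symmetric]) measurable
  finally show ?thesis .
qed

text \<open>The decoder picks any state that sends the report and reads off its agreement component;
  all senders share it.\<close>

lemma reveals_agreement_lift: "reveals_agreement P b \<rho>"
  unfolding reveals_agreement_def
proof (intro exI ballI)
  fix w assume w: "w \<in> space P"
  then have "(SOME w'. w' \<in> space P \<and> \<rho> w' = \<rho> w) \<in> space P \<and>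
      \<rho> (SOME w'. w' \<in> space P \<and> \<rho> w' = \<rho> w) = \<rho> w"
    by (intro someI[where P = "\<lambda>w'. w' \<in> space P \<and> \<rho> w' = \<rho> w"]) simp
  then show "(\<lambda>r. agreement b (SOME w'. w' \<in> space P \<and> \<rho> w' = r)) (\<rho> w) = agreement b w"
    using lift_strategy_eqD(1) w by blast
qed

section \<open>Equilibrium property of the lift\<close>

lemma lift_strategy_in_lift_reports:
  "w \<in> space P \<Longrightarrow> \<rho> w \<in> lift_reports W b n t"
  using cell_index_props(1)[OF partition, of "conflict b w"]
  by (auto simp: lift_reports_def lift_strategy_def space_P)

text \<open>
  Reports that no state sends (such as the empty cell) are answered like some report that is sent,
  so they offer no new deviation.
\<close>

lemma ex_lifted_equilibrium:
  assumes "scalar_equilibrium (norm b) \<pi>s lo hi up n t"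
  shows "\<exists>\<alpha>. lifted_equilibrium P \<pi>s W b lo hi up n t \<alpha> \<and> manipulates_only_along P b \<rho> \<alpha>"
proof -
  have "\<forall>r. \<exists>w. w \<in> space P \<and> (r \<in> \<rho> ` space P \<longrightarrow> \<rho> w = r)"
    using not_empty by blast
  then obtain sender where sender:
    "\<And>r. sender r \<in> space P" "\<And>r. r \<in> \<rho> ` space P \<Longrightarrow> \<rho> (sender r) = r"
    by metis
  define \<alpha> where "\<alpha> r = response (sender r)" for r
  have \<alpha>: "\<alpha> (\<rho> w) = response w" if "w \<in> space P" for w
    unfolding \<alpha>_def using that sender by (intro response_cong) auto
  \<comment> \<open>Every report is answered by the response to some state \<open>w'\<close>, so
    comparing such responses covers all deviations.\<close>
  have "user_utility b w (response w') \<le> user_utility b w (response w)"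
    if w: "w \<in> space P" "w' \<in> space P" for w w'
  proof -
    let ?s = "conflict b w" and ?j = "idx (conflict b w')"
    have "(\<Phi> (idx ?s) - ?s - norm b)\<^sup>2 \<le> (\<Phi> ?j - ?s - norm b)\<^sup>2"
      using assms cell_index_props[OF partition] w
      by (auto simp: scalar_equilibrium_def space_P)
    then show ?thesis
      using zero_le_power2[of "norm (agreement b w' - agreement b w)"]
      unfolding response_def user_utility_eq[OF bias] diff_self norm_zero zero_power2 by linarith
  qed
  then have "user_utility b w (\<alpha> r) \<le> user_utility b w (\<alpha> (\<rho> w))" if "w \<in> space P" for w r
    unfolding \<alpha>[OF that] using that sender(1) by (simp add: \<alpha>_def)
  then have "equilibrium P b (lift_reports W b n t) \<rho> \<alpha>"
    using posterior_meanI[OF \<alpha>] lift_strategy_in_lift_reports by (simp add: equilibrium_def)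
  moreover have "manipulates_only_along P b \<rho> \<alpha>"
    unfolding manipulates_only_along_def
  proof
    fix w assume w: "w \<in> space P"
    have "response w = w + (\<Phi> (idx (conflict b w)) - conflict b w) *\<^sub>R u"
      using agreement_plus_conflict[of b w] by (simp add: response_def algebra_simps)
    then show "\<exists>c. \<alpha> (\<rho> w) = w + c *\<^sub>R u" using \<alpha>[OF w] by auto
  qed
  ultimately show ?thesis using assms by (auto simp: lifted_equilibrium_def)
qed

end

text \<open>With \<open>n\<close>, \<open>t\<close> and \<alpha> free, this turns the comparison of
  lifted equilibria into that of their scalar partitions.\<close>

lemma (in factorized_prior) ex_ante_user_utility_lifted_equilibrium:
  assumes "lifted_equilibrium P \<pi>s W b lo hi up n t \<alpha>"
  shows "ex_ante_user_utility P b (lift_strategy W b up n t) \<alpha> =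
    scalar_ex_ante_utility (norm b) \<pi>s up n t"
proof -
  interpret lifted_partition P \<pi>s \<pi>z W b lo hi up n t
    using assms by unfold_locales (simp add: lifted_equilibrium_def scalar_equilibrium_def)
  show ?thesis
    using assms by (intro ex_ante_user_utility_lift)
      (simp add: lifted_equilibrium_def equilibrium_def)
qed

theorem theorem5p7:
  fixes M :: "'d measure" and wstar :: "'d \<Rightarrow> 'a::euclidean_space"
    and W :: "'a set" and b :: 'a and lo hi :: real
    and \<pi>w :: "'a measure" and \<pi>s :: "real measure" and \<pi>z :: "'a measure"
    and up :: "real \<Rightarrow> bool" and n :: nat and t :: "nat \<Rightarrow> real"
  assumes dim: "DIM('a) > 1" and bias: "b \<noteq> 0"
    and prob: "prob_space M"
    and W: "W \<in> sets borel"
    and wstar: "wstar \<in> borel_measurable M"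
    and wstar_W: "\<And>D. D \<in> space M \<Longrightarrow> wstar D \<in> W"
    and range: "\<And>D. D \<in> space M \<Longrightarrow> conflict b (wstar D) \<in> {lo..hi}"
    and \<pi>w: "\<pi>w = distr M (restrict_space borel {w \<in> W. conflict b w \<in> {lo..hi}}) wstar"
    and \<pi>s: "\<pi>s = distr M borel (\<lambda>D. conflict b (wstar D))"
    and \<pi>z: "\<pi>z = distr M borel (\<lambda>D. agreement b (wstar D))"
    and factorized:
      "distr M (borel \<Otimes>\<^sub>M borel) (\<lambda>D. (conflict b (wstar D), agreement b (wstar D)))
       = \<pi>s \<Otimes>\<^sub>M \<pi>z"
  shows "(scalar_equilibrium (norm b) \<pi>s lo hi up n t \<longrightarrow>
           (\<exists>\<alpha>. lifted_equilibrium \<pi>w \<pi>s W b lo hi up n t \<alpha> \<and>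
                reveals_agreement \<pi>w b (lift_strategy W b up n t) \<and>
                manipulates_only_along \<pi>w b (lift_strategy W b up n t) \<alpha>)) \<and>
         (scalar_user_optimal (norm b) \<pi>s lo hi up n t \<longrightarrow>
           (\<forall>\<alpha>. lifted_equilibrium \<pi>w \<pi>s W b lo hi up n t \<alpha> \<longrightarrow>
                user_optimal_lifted \<pi>w \<pi>s W b lo hi up n t \<alpha>))"
proof -
  let ?S = "{w \<in> W. conflict b w \<in> {lo..hi}}"
  interpret M: prob_space M by (rule prob)
  have wstar_S [measurable]: "wstar \<in> measurable M (restrict_space borel ?S)"
    using wstar wstar_W range by (intro measurable_restrict_space2) auto
  \<comment> \<open>Laws of functions of the parameter are the same computed from datasets or from
    states, which carries the factorization over to \<open>\<pi>w\<close>.\<close>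
  have distr_prior: "distr \<pi>w N f = distr M N (\<lambda>D. f (wstar D))" if "f \<in> measurable borel N"
    for f :: "'a \<Rightarrow> 'c" and N
    unfolding \<pi>w using that
    by (subst distr_distr[OF measurable_restrict_space1 wstar_S]) (auto simp: comp_def)
  interpret prob_space \<pi>w unfolding \<pi>w by (rule M.prob_space_distr) measurable
  interpret factorized_prior \<pi>w \<pi>s \<pi>z W b lo hi
  proof
    show "\<pi>s = distr \<pi>w borel (conflict b)" unfolding \<pi>s by (rule distr_prior[symmetric]) measurable
    show "\<pi>z = distr \<pi>w borel (agreement b)" unfolding \<pi>z by (rule distr_prior[symmetric]) measurable
    show "distr \<pi>w (borel \<Otimes>\<^sub>M borel) (\<lambda>w. (conflict b w, agreement b w)) = \<pi>s \<Otimes>\<^sub>M \<pi>z"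
      unfolding factorized[symmetric] by (rule distr_prior) measurable
  qed (use bias W in \<open>simp_all add: \<pi>w\<close>)
  show ?thesis
  proof (intro conjI impI allI)
    assume eq: "scalar_equilibrium (norm b) \<pi>s lo hi up n t"
    interpret lifted_partition \<pi>w \<pi>s \<pi>z W b lo hi up n t
      using eq by unfold_locales (simp add: scalar_equilibrium_def)
    show "\<exists>\<alpha>. lifted_equilibrium \<pi>w \<pi>s W b lo hi up n t \<alpha> \<and>
        reveals_agreement \<pi>w b (lift_strategy W b up n t) \<and>
        manipulates_only_along \<pi>w b (lift_strategy W b up n t) \<alpha>"
      using ex_lifted_equilibrium[OF eq] reveals_agreement_lift by blast
  next
    fix \<alpha> assume "scalar_user_optimal (norm b) \<pi>s lo hi up n t"
      and "lifted_equilibrium \<pi>w \<pi>s W b lo hi up n t \<alpha>"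
    \<comment> \<open>A competing lifted equilibrium contains a scalar equilibrium by definition, so
      scalar optimality compares the two utilities.\<close>
    then show "user_optimal_lifted \<pi>w \<pi>s W b lo hi up n t \<alpha>"
      unfolding user_optimal_lifted_def
      by (auto simp: ex_ante_user_utility_lifted_equilibrium scalar_user_optimal_def
          lifted_equilibrium_def)
  qed
qed

end
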